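(* For all integers $s\ge2$, $\Pi^s_{\mathcal A}\cong\mathcal{J}(\mathcal{A}^s,V^s_{\mathcal A})$ as algebras.
   Context: Conventions: algebras are over $\mathbb{C}$; $\mathbb{N}$ contains $0$; a product of paths $pq$ means "first $p$, then $q$"; $e_x$ is the trivial path at $x$. A quiver with potential $(Q,W)$ is a quiver with a linear combination $W$ of cycles (cycles regarded up to cyclic permutation); its Jacobian algebra is $\mathcal{J}(Q,W)=\mathbb{C}Q/\langle\partial_\alpha W\mid\alpha\in Q_1\rangle$, where $\partial_\alpha(\alpha_1\cdots\alpha_l)=\sum_{\alpha_i=\alpha}\alpha_{i+1}\cdots\alpha_l\alpha_1\cdots\alpha_{i-1}$. Let $f_0=(-1,1,0)$, $f_1=(0,-1,1)$, $f_2=(1,0,-1)$. For $s\ge 2$, $\mathcal{A}^s$ is the quiver with vertices $\mathcal{A}^s_0=\{x\in\mathbb{N}^3\mid x_0+x_1+x_2=s-1\}$ and an arrow $e_x\alpha_i\colon x\to x+f_i$ whenever $i\in\{0,1,2\}$ and $x,x+f_i\in\mathcal{A}^s_0$. Every 3-cycle of $\mathcal{A}^s$ is, up to rotation, of the form $e_x\alpha_0\alpha_1\alpha_2$ or $e_x\alpha_0\alpha_2\alpha_1$. The potential $W^s_{\mathcal A}$ is the sum of all 3-cycles $e_x\alpha_0\alpha_1\alpha_2$ minus the sum of all 3-cycles $e_x\alpha_0\alpha_2\alpha_1$, and $\Pi^s_{\mathcal A}=\mathcal{J}(\mathcal{A}^s,W^s_{\mathcal A})$. Let $q=e^{\pi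 i/(s+2)}$ and $[n]=(q^n-q^{-n})/(q-q^{-1})$. The potential $V^s_{\mathcal A}=\sum_c\mu_{\mathcal A}(c)c$ is the sum over all 3-cycles in $\mathcal{A}^s$ (up to rotation), where for $x=(x_0,x_1,x_2)\in\mathcal{A}^s_0$ $$\mu_{\mathcal A}(e_x\alpha_0\alpha_1\alpha_2)=\sqrt{[x_1+1][x_1+2][x_2+1][x_2+2][x_1+x_2+2][x_1+x_2+3]}\,/\,[2],$$ $$\mu_{\mathcal A}(e_x\alpha_0\alpha_2\alpha_1)=\sqrt{[x_1+1][x_1+2][x_2][x_2+1][x_1+x_2+2][x_1+x_2+3]}\,/\,[2].$$ *)

theory Defs
  imports
    Complex_Main
    "HOL-Library.Product_Plus"
    "HOL-Algebra.Module"
    "HOL-Algebra.QuotRing"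
    "Graph_Theory.Arc_Walk"
begin

text \<open>
  A quiver is a directed multigraph in the sense of \<^typ>\<open>('v, 'a) pre_digraph\<close>. A path is recorded
  as its initial vertex together with its list of arrows, so that \<open>(u, [])\<close> is the trivial path at
  \<open>u\<close>; elements of the path algebra are finitely supported functions on paths.
\<close>

type_synonym ('v, 'a) path = "'v \<times> 'a list"

definition paths :: "('v, 'a) pre_digraph \<Rightarrow> ('v, 'a) path set" where
  "paths Q = {(u, p). \<exists>v. pre_digraph.awalk Q u p v}"

definition path_elem :: "('v, 'a) path \<Rightarrow> ('v, 'a) path \<Rightarrow> complex" where
  "path_elem c = (\<lambda>r. if r = c then 1 else 0)"

text \<open>
  The coefficient of a path in \<open>f \<otimes> g\<close> is the sum over all ways of cutting the path into a first
  part (evaluated by \<open>f\<close>) followed by a second part (evaluated by \<open>g\<close>).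
\<close>

definition path_algebra ::
  "('v, 'a) pre_digraph \<Rightarrow> (complex, ('v, 'a) path \<Rightarrow> complex) module" where
  "path_algebra Q =
    \<lparr>carrier = {f. finite {c. f c \<noteq> 0} \<and> {c. f c \<noteq> 0} \<subseteq> paths Q},
     mult = (\<lambda>f g (u, p). \<Sum>k\<le>length p.
        f (u, take k p) * g (pre_digraph.awlast Q u (take k p), drop k p)),
     one = (\<lambda>(u, p). if u \<in> verts Q \<and> p = [] then 1 else 0),
     zero = (\<lambda>_. 0),
     add = (\<lambda>f g c. f c + g c),
     smult = (\<lambda>z f c. z * f c)\<rparr>"

definition quot_algebra :: "('k, 'b) module \<Rightarrow> 'b set \<Rightarrow> ('k, 'b set) module" where
  "quot_algebra A I = ring.extend (A Quot I)
     (module.fields (\<lambda>z X. \<Union>x\<in>X. I +>\<^bsub>A\<^esub> (z \<odot>\<^bsub>A\<^esub> x)))"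

definition algebra_isomorphic :: "(complex, 'b) module \<Rightarrow> (complex, 'c) module \<Rightarrow> bool" where
  "algebra_isomorphic A B \<longleftrightarrow>
    (\<exists>h \<in> ring_iso A B. \<forall>z. \<forall>x \<in> carrier A. h (z \<odot>\<^bsub>A\<^esub> x) = z \<odot>\<^bsub>B\<^esub> h x)"

text \<open>
  A potential is given by choosing a representative in each rotation class of cycles that occurs.
  The choice is immaterial for the cyclic derivatives, see \<open>cyc_deriv_path_rotate\<close> below.
\<close>

definition potential :: "('v, 'a) pre_digraph \<Rightarrow> (('v, 'a) path \<Rightarrow> complex) \<Rightarrow> bool" where
  "potential Q W \<longleftrightarrow> finite {c. W c \<noteq> 0} \<and>
    (\<forall>u p. W (u, p) \<noteq> 0 \<longrightarrow> p \<noteq> [] \<and> pre_digraph.awalk Q u p u)"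

definition cyc_deriv_path ::
  "('v, 'a) pre_digraph \<Rightarrow> 'a \<Rightarrow> 'a list \<Rightarrow> ('v, 'a) path \<Rightarrow> complex" where
  "cyc_deriv_path Q a p = (\<lambda>r. \<Sum>i | i < length p \<and> p ! i = a.
     path_elem (head Q a, drop (Suc i) p @ take i p) r)"

definition cyc_deriv ::
  "('v, 'a) pre_digraph \<Rightarrow> 'a \<Rightarrow> (('v, 'a) path \<Rightarrow> complex) \<Rightarrow> ('v, 'a) path \<Rightarrow> complex" where
  "cyc_deriv Q a W = (\<lambda>r. \<Sum>c | W c \<noteq> 0. W c * cyc_deriv_path Q a (snd c) r)"

definition jacobian_ideal ::
  "('v, 'a) pre_digraph \<Rightarrow> (('v, 'a) path \<Rightarrow> complex) \<Rightarrow> (('v, 'a) path \<Rightarrow> complex) set" where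
  "jacobian_ideal Q W = genideal (path_algebra Q) {cyc_deriv Q a W | a. a \<in> arcs Q}"

definition jacobian_algebra ::
  "('v, 'a) pre_digraph \<Rightarrow> (('v, 'a) path \<Rightarrow> complex) \<Rightarrow> (complex, (('v, 'a) path \<Rightarrow> complex) set) module"
  where
  "jacobian_algebra Q W = quot_algebra (path_algebra Q) (jacobian_ideal Q W)"

type_synonym vertex = "int \<times> int \<times> int"
type_synonym arrow = "vertex \<times> nat"

definition step :: "nat \<Rightarrow> vertex" where
  "step i = (if i = 0 then (-1, 1, 0) else if i = 1 then (0, -1, 1) else (1, 0, -1))"

definition vertsA :: "nat \<Rightarrow> vertex set" where
  "vertsA s = {(x0, x1, x2). 0 \<le> x0 \<and> 0 \<le> x1 \<and> 0 \<le> x2 \<and> x0 + x1 + x2 = int s - 1}"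

text \<open>The pair \<open>(x, i)\<close> is the arrow \<open>e\<^sub>x \<alpha>\<^sub>i\<close>.\<close>

definition quiverA :: "nat \<Rightarrow> (vertex, arrow) pre_digraph" where
  "quiverA s =
    \<lparr>verts = vertsA s,
     arcs = {(x, i). i \<in> {0, 1, 2} \<and> x \<in> vertsA s \<and> x + step i \<in> vertsA s},
     tail = (\<lambda>(x, i). x),
     head = (\<lambda>(x, i). x + step i)\<rparr>"

text \<open>\<open>(x, arrows x [i, j, \<dots>])\<close> is the path \<open>e\<^sub>x \<alpha>\<^sub>i \<alpha>\<^sub>j \<dots>\<close>.\<close>

primrec arrows :: "vertex \<Rightarrow> nat list \<Rightarrow> arrow list" where
  "arrows x [] = []"
| "arrows x (i # is) = (x, i) # arrows (x + step i) is"

text \<open>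
  Weighted sum of all cycles of the form \<open>e\<^sub>x \<alpha>\<^sub>i \<alpha>\<^sub>j \<dots>\<close>. Every 3-cycle of the quiver has exactly one
  rotation of the form \<open>e\<^sub>x \<alpha>\<^sub>0 \<alpha>\<^sub>1 \<alpha>\<^sub>2\<close> or \<open>e\<^sub>x \<alpha>\<^sub>0 \<alpha>\<^sub>2 \<alpha>\<^sub>1\<close>, see \<open>three_cycles_up_to_rotation\<close> below.
\<close>

definition cycle_sum :: "nat \<Rightarrow> nat list \<Rightarrow> (vertex \<Rightarrow> complex) \<Rightarrow> (vertex, arrow) path \<Rightarrow> complex" where
  "cycle_sum s is m = (\<lambda>r. \<Sum>x | pre_digraph.awalk (quiverA s) x (arrows x is) x.
     m x * path_elem (x, arrows x is) r)"

definition WA :: "nat \<Rightarrow> (vertex, arrow) path \<Rightarrow> complex" where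
  "WA s = (\<lambda>r. cycle_sum s [0, 1, 2] (\<lambda>_. 1) r - cycle_sum s [0, 2, 1] (\<lambda>_. 1) r)"

definition PiA :: "nat \<Rightarrow> (complex, ((vertex, arrow) path \<Rightarrow> complex) set) module" where
  "PiA s = jacobian_algebra (quiverA s) (WA s)"

definition qpar :: "nat \<Rightarrow> complex" where
  "qpar s = exp (of_real pi * \<i> / of_nat (s + 2))"

definition qnum :: "nat \<Rightarrow> int \<Rightarrow> complex" where
  "qnum s n = (qpar s powi n - qpar s powi (-n)) / (qpar s - inverse (qpar s))"

text \<open>
  On the cycles over which \<open>VA\<close> below sums, all radicands are positive reals, on which \<^const>\<open>csqrt\<close>
  is the positive square root.
\<close>

fun mu012 :: "nat \<Rightarrow> vertex \<Rightarrow> complex" where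
  "mu012 s (x0, x1, x2) =
     csqrt (qnum s (x1 + 1) * qnum s (x1 + 2) * qnum s (x2 + 1) * qnum s (x2 + 2)
            * qnum s (x1 + x2 + 2) * qnum s (x1 + x2 + 3)) / qnum s 2"

fun mu021 :: "nat \<Rightarrow> vertex \<Rightarrow> complex" where
  "mu021 s (x0, x1, x2) =
     csqrt (qnum s (x1 + 1) * qnum s (x1 + 2) * qnum s x2 * qnum s (x2 + 1)
            * qnum s (x1 + x2 + 2) * qnum s (x1 + x2 + 3)) / qnum s 2"

definition VA :: "nat \<Rightarrow> (vertex, arrow) path \<Rightarrow> complex" where
  "VA s = (\<lambda>r. cycle_sum s [0, 1, 2] (mu012 s) r + cycle_sum s [0, 2, 1] (mu021 s) r)"

lemma awlast_conv: "pre_digraph.awlast Q u p = (if p = [] then u else head Q (last p))"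
  by (simp add: pre_digraph.awalk_verts_conv)

lemma cas_iff:
  "pre_digraph.cas Q u p v \<longleftrightarrow> pre_digraph.cas Q u p (pre_digraph.awlast Q u p)
     \<and> v = pre_digraph.awlast Q u p"
proof (induction p arbitrary: u)
  case Nil
  then show ?case by (auto simp: pre_digraph.cas.simps awlast_conv)
next
  case (Cons e p)
  have "pre_digraph.awlast Q u (e # p) = pre_digraph.awlast Q (head Q e) p"
    by (simp add: awlast_conv)
  then show ?case
    using Cons[of "head Q e"] by (simp add: pre_digraph.cas.simps)
qed

lemma cas_append:
  "pre_digraph.cas Q u (p @ p') w \<longleftrightarrow>
     (\<exists>v. pre_digraph.cas Q u p v \<and> pre_digraph.cas Q v p' w)"
  by (induction p arbitrary: u) (simp_all add: pre_digraph.cas.simps)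

lemma mem_paths_iff:
  "(u, p) \<in> paths Q \<longleftrightarrow>
     u \<in> verts Q \<and> set p \<subseteq> arcs Q \<and> pre_digraph.cas Q u p (pre_digraph.awlast Q u p)"
  proof -
  have "(\<exists>v. pre_digraph.cas Q u p v) \<longleftrightarrow> pre_digraph.cas Q u p (pre_digraph.awlast Q u p)"
    using cas_iff[of Q u p] by metis
  then show ?thesis
    unfolding paths_def pre_digraph.awalk_def by simp
qed

lemma awlast_append:
  "pre_digraph.awlast Q (pre_digraph.awlast Q u p) p' = pre_digraph.awlast Q u (p @ p')"
  by (simp add: awlast_conv)

lemma paths_append:
  assumes "wf_digraph Q"
  shows "(u, p @ p') \<in> paths Q \<longleftrightarrow>
    (u, p) \<in> paths Q \<and> (pre_digraph.awlast Q u p, p') \<in> paths Q"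
proof -
  have "pre_digraph.awlast Q u p \<in> verts Q" if "u \<in> verts Q" "set p \<subseteq> arcs Q"
    using that wf_digraph.awlast_in_verts[OF assms] by blast
  moreover have "pre_digraph.cas Q u (p @ p') (pre_digraph.awlast Q u (p @ p')) \<longleftrightarrow>
      pre_digraph.cas Q u p (pre_digraph.awlast Q u p) \<and>
      pre_digraph.cas Q (pre_digraph.awlast Q u p) p'
        (pre_digraph.awlast Q (pre_digraph.awlast Q u p) p')"
  proof -
    have "(\<exists>v. P v \<and> Q' v) \<longleftrightarrow> P v0 \<and> Q' v0" if "\<And>v. P v \<longleftrightarrow> P v0 \<and> v = v0" for P Q' and v0 :: 'a
      using that by metis
    from this[OF cas_iff] show ?thesis
      unfolding cas_append awlast_append .
  qed
  ultimately show ?thesis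
    unfolding mem_paths_iff by auto
qed

lemma path_algebra_simps:
  "f \<in> carrier (path_algebra Q) \<longleftrightarrow> finite {c. f c \<noteq> 0} \<and> {c. f c \<noteq> 0} \<subseteq> paths Q"
  "(f \<otimes>\<^bsub>path_algebra Q\<^esub> g) (u, p) =
     (\<Sum>k\<le>length p. f (u, take k p) * g (pre_digraph.awlast Q u (take k p), drop k p))"
  "\<one>\<^bsub>path_algebra Q\<^esub> (u, p) = (if u \<in> verts Q \<and> p = [] then 1 else 0)"
  "\<zero>\<^bsub>path_algebra Q\<^esub> = (\<lambda>_. 0)"
  "(f \<oplus>\<^bsub>path_algebra Q\<^esub> g) = (\<lambda>c. f c + g c)"
  "(z \<odot>\<^bsub>path_algebra Q\<^esub> f) = (\<lambda>c. z * f c)"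
  by (simp_all add: path_algebra_def)

lemma path_algebra_mult_closed:
  assumes "wf_digraph Q" "f \<in> carrier (path_algebra Q)" "g \<in> carrier (path_algebra Q)"
  shows "f \<otimes>\<^bsub>path_algebra Q\<^esub> g \<in> carrier (path_algebra Q)"
proof -
  let ?T = "(\<lambda>((u, p), (v, p')). (u, p @ p')) ` ({c. f c \<noteq> 0} \<times> {c. g c \<noteq> 0})"
  have fin: "finite {c. f c \<noteq> 0}" "finite {c. g c \<noteq> 0}"
    and sub: "{c. f c \<noteq> 0} \<subseteq> paths Q" "{c. g c \<noteq> 0} \<subseteq> paths Q"
    using assms(2,3) by (simp_all add: path_algebra_simps)
  have *: "(u, r) \<in> ?T \<inter> paths Q" if nz: "(f \<otimes>\<^bsub>path_algebra Q\<^esub> g) (u, r) \<noteq> 0" for u r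
  proof -
    obtain k where "f (u, take k r) * g (pre_digraph.awlast Q u (take k r), drop k r) \<noteq> 0"
      using nz unfolding path_algebra_simps by (meson sum.not_neutral_contains_not_neutral)
    then have f: "f (u, take k r) \<noteq> 0"
      and g: "g (pre_digraph.awlast Q u (take k r), drop k r) \<noteq> 0" by auto
    have "(u, take k r) \<in> paths Q" "(pre_digraph.awlast Q u (take k r), drop k r) \<in> paths Q"
      using f g sub by auto
    then have "(u, take k r @ drop k r) \<in> paths Q"
      using paths_append[OF assms(1)] by blast
    moreover have "(u, r) = (\<lambda>((u, p), (v, p')). (u, p @ p'))
        ((u, take k r), (pre_digraph.awlast Q u (take k r), drop k r))"
      by simp
    moreover have "((u, take k r), (pre_digraph.awlast Q u (take k r), drop k r)) \<in>
        {c. f c \<noteq> 0} \<times> {c. g c \<noteq> 0}"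
      using f g by simp
    ultimately have "(u, r) \<in> ?T"
      by (intro image_eqI)
    then show ?thesis
      using \<open>(u, take k r @ drop k r) \<in> paths Q\<close> by simp
  qed
  have "{c. (f \<otimes>\<^bsub>path_algebra Q\<^esub> g) c \<noteq> 0} \<subseteq> ?T \<inter> paths Q"
  proof clarify
    fix u r assume "(f \<otimes>\<^bsub>path_algebra Q\<^esub> g) (u, r) \<noteq> 0"
    then show "(u, r) \<in> ?T \<inter> paths Q" by (rule *)
  qed
  moreover have "finite ?T"
    using fin by blast
  ultimately show ?thesis
    unfolding path_algebra_simps(1) by (meson finite_subset le_inf_iff)
qed

lemma path_algebra_mult_assoc:
  "(f \<otimes>\<^bsub>path_algebra Q\<^esub> g) \<otimes>\<^bsub>path_algebra Q\<^esub> h = f \<otimes>\<^bsub>path_algebra Q\<^esub> (g \<otimes>\<^bsub>path_algebra Q\<^esub> h)"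
proof (rule ext, clarify)
  fix u :: 'a and p :: "'b list"
  let ?l = "pre_digraph.awlast Q"
  let ?n = "length p"
  let ?F = "\<lambda>j k. f (u, take j p) * g (?l u (take j p), drop j (take k p)) * h (?l u (take k p), drop k p)"
  have "((f \<otimes>\<^bsub>path_algebra Q\<^esub> g) \<otimes>\<^bsub>path_algebra Q\<^esub> h) (u, p) = (\<Sum>k\<le>?n. \<Sum>j\<le>k. ?F j k)"
    unfolding path_algebra_simps by (auto simp: sum_distrib_right min_def intro!: sum.cong)
  also have "\<dots> = (\<Sum>(k, j)\<in>Sigma {..?n} (\<lambda>k. {..k}). ?F j k)"
    by (simp add: sum.Sigma)
  also have "\<dots> = (\<Sum>(j, i)\<in>Sigma {..?n} (\<lambda>j. {..?n - j}). ?F j (j + i))"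
    by (rule sum.reindex_bij_witness[where i = "\<lambda>(j, i). (j + i, j)" and j = "\<lambda>(k, j). (j, k - j)"]) auto
  also have "\<dots> = (\<Sum>j\<le>?n. \<Sum>i\<le>?n - j. ?F j (j + i))"
    by (simp add: sum.Sigma)
  also have "\<dots> = (f \<otimes>\<^bsub>path_algebra Q\<^esub> (g \<otimes>\<^bsub>path_algebra Q\<^esub> h)) (u, p)"
    unfolding path_algebra_simps
    by (auto simp: sum_distrib_left awlast_append drop_take take_add[symmetric] add.commute mult.assoc
        intro!: sum.cong)
  finally show "((f \<otimes>\<^bsub>path_algebra Q\<^esub> g) \<otimes>\<^bsub>path_algebra Q\<^esub> h) (u, p) =
      (f \<otimes>\<^bsub>path_algebra Q\<^esub> (g \<otimes>\<^bsub>path_algebra Q\<^esub> h)) (u, p)" .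
qed

lemma path_algebra_one_closed:
  assumes "fin_digraph Q"
  shows "\<one>\<^bsub>path_algebra Q\<^esub> \<in> carrier (path_algebra Q)"
proof -
  have "{c. \<one>\<^bsub>path_algebra Q\<^esub> c \<noteq> 0} = (\<lambda>u. (u, [])) ` verts Q"
    by (auto simp: path_algebra_simps split: if_splits)
  then show ?thesis
    using fin_digraph.finite_verts[OF assms]
    by (auto simp: path_algebra_simps(1) mem_paths_iff pre_digraph.cas.simps awlast_conv)
qed

lemma path_algebra_one_mult:
  assumes "wf_digraph Q" "f \<in> carrier (path_algebra Q)"
  shows "\<one>\<^bsub>path_algebra Q\<^esub> \<otimes>\<^bsub>path_algebra Q\<^esub> f = f" "f \<otimes>\<^bsub>path_algebra Q\<^esub> \<one>\<^bsub>path_algebra Q\<^esub> = f"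
proof -
  have path: "(u, p) \<in> paths Q" if "f (u, p) \<noteq> 0" for u p
    using that assms(2) by (auto simp: path_algebra_simps)
  have "(\<one>\<^bsub>path_algebra Q\<^esub> \<otimes>\<^bsub>path_algebra Q\<^esub> f) (u, p) = f (u, p)" for u p
  proof -
    have "(\<one>\<^bsub>path_algebra Q\<^esub> \<otimes>\<^bsub>path_algebra Q\<^esub> f) (u, p) =
        (\<Sum>k\<le>length p. if k = 0 then (if u \<in> verts Q then f (u, p) else 0) else 0)"
      unfolding path_algebra_simps by (intro sum.cong) (auto simp: awlast_conv)
    then show ?thesis
      using path[of u p] by (auto simp: mem_paths_iff)
  qed
  then show "\<one>\<^bsub>path_algebra Q\<^esub> \<otimes>\<^bsub>path_algebra Q\<^esub> f = f" by auto
  have "(f \<otimes>\<^bsub>path_algebra Q\<^esub> \<one>\<^bsub>path_algebra Q\<^esub>) (u, p) = f (u, p)" for u p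
  proof -
    have "(f \<otimes>\<^bsub>path_algebra Q\<^esub> \<one>\<^bsub>path_algebra Q\<^esub>) (u, p) =
        (\<Sum>k\<le>length p. if k = length p then
           (if pre_digraph.awlast Q u p \<in> verts Q then f (u, p) else 0) else 0)"
      unfolding path_algebra_simps by (intro sum.cong) auto
    then show ?thesis
      using path[of u p] wf_digraph.awlast_in_verts[OF assms(1)] by (auto simp: mem_paths_iff)
  qed
  then show "f \<otimes>\<^bsub>path_algebra Q\<^esub> \<one>\<^bsub>path_algebra Q\<^esub> = f" by auto
qed

lemma path_algebra_add_closed:
  assumes "f \<in> carrier (path_algebra Q)" "g \<in> carrier (path_algebra Q)"
  shows "f \<oplus>\<^bsub>path_algebra Q\<^esub> g \<in> carrier (path_algebra Q)"
proof -
  have "{c. f c + g c \<noteq> 0} \<subseteq> {c. f c \<noteq> 0} \<union> {c. g c \<noteq> 0}" by auto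
  then show ?thesis
    using assms unfolding path_algebra_simps
    by (meson finite_UnI finite_subset le_sup_iff order_trans)
qed

lemma path_algebra_smult_closed:
  "f \<in> carrier (path_algebra Q) \<Longrightarrow> z \<odot>\<^bsub>path_algebra Q\<^esub> f \<in> carrier (path_algebra Q)"
  by (cases "z = 0") (auto simp: path_algebra_simps)

lemma path_algebra_smult_mult:
  "(z \<odot>\<^bsub>path_algebra Q\<^esub> f) \<otimes>\<^bsub>path_algebra Q\<^esub> g = z \<odot>\<^bsub>path_algebra Q\<^esub> (f \<otimes>\<^bsub>path_algebra Q\<^esub> g)"
  "f \<otimes>\<^bsub>path_algebra Q\<^esub> (z \<odot>\<^bsub>path_algebra Q\<^esub> g) = z \<odot>\<^bsub>path_algebra Q\<^esub> (f \<otimes>\<^bsub>path_algebra Q\<^esub> g)"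
  by (auto simp: path_algebra_simps sum_distrib_left algebra_simps intro!: sum.cong)

lemma path_algebra_ring:
  assumes "fin_digraph Q"
  shows "ring (path_algebra Q)"
proof -
  have wf: "wf_digraph Q"
    using assms by (simp add: fin_digraph_def)
  show ?thesis
  proof (intro ringI abelian_groupI monoidI)
    fix f assume f: "f \<in> carrier (path_algebra Q)"
    have "(- 1) \<odot>\<^bsub>path_algebra Q\<^esub> f \<oplus>\<^bsub>path_algebra Q\<^esub> f = \<zero>\<^bsub>path_algebra Q\<^esub>"
      by (simp add: path_algebra_simps)
    then show "\<exists>g\<in>carrier (path_algebra Q). g \<oplus>\<^bsub>path_algebra Q\<^esub> f = \<zero>\<^bsub>path_algebra Q\<^esub>"
      using path_algebra_smult_closed[OF f] by blast
  next
    fix f g h :: "('a, 'b) path \<Rightarrow> complex"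
    show "(f \<oplus>\<^bsub>path_algebra Q\<^esub> g) \<otimes>\<^bsub>path_algebra Q\<^esub> h =
        f \<otimes>\<^bsub>path_algebra Q\<^esub> h \<oplus>\<^bsub>path_algebra Q\<^esub> g \<otimes>\<^bsub>path_algebra Q\<^esub> h"
      "h \<otimes>\<^bsub>path_algebra Q\<^esub> (f \<oplus>\<^bsub>path_algebra Q\<^esub> g) =
        h \<otimes>\<^bsub>path_algebra Q\<^esub> f \<oplus>\<^bsub>path_algebra Q\<^esub> h \<otimes>\<^bsub>path_algebra Q\<^esub> g"
      by (auto simp: path_algebra_simps algebra_simps sum.distrib)
  next
    show "\<zero>\<^bsub>path_algebra Q\<^esub> \<in> carrier (path_algebra Q)" by (simp add: path_algebra_simps)
  qed (use path_algebra_mult_closed[OF wf] path_algebra_one_closed[OF assms]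
      path_algebra_one_mult[OF wf] path_algebra_add_closed in
      \<open>simp_all add: path_algebra_mult_assoc path_algebra_simps(4,5) add.commute add.left_commute\<close>)
qed

lemma cyc_deriv_path_rotate: "cyc_deriv_path Q a (rotate k p) = cyc_deriv_path Q a p"
proof -
  have conv: "cyc_deriv_path Q a p r = (\<Sum>i<length p. if hd (rotate i p) = a
      then path_elem (head Q a, tl (rotate i p)) r else 0)" for p r
  proof -
    have "cyc_deriv_path Q a p r = (\<Sum>i<length p. if p ! i = a
        then path_elem (head Q a, drop (Suc i) p @ take i p) r else 0)"
      unfolding cyc_deriv_path_def by (simp add: sum.If_cases Int_def)
    also have "\<dots> = (\<Sum>i<length p. if hd (rotate i p) = a
        then path_elem (head Q a, tl (rotate i p)) r else 0)"
    proof (rule sum.cong)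
      fix i assume "i \<in> {..<length p}"
      then have "rotate i p = p ! i # drop (Suc i) p @ take i p"
        by (simp add: rotate_drop_take Cons_nth_drop_Suc[symmetric])
      then show "(if p ! i = a then path_elem (head Q a, drop (Suc i) p @ take i p) r else 0) =
          (if hd (rotate i p) = a then path_elem (head Q a, tl (rotate i p)) r else 0)"
        by simp
    qed simp
    finally show ?thesis .
  qed
  have "cyc_deriv_path Q a (rotate1 p) r = cyc_deriv_path Q a p r" for p r
  proof -
    define g where "g i = (if hd (rotate i p) = a then path_elem (head Q a, tl (rotate i p)) r else 0)" for i
    have 1: "(\<Sum>i<length p. g (Suc i)) + g 0 = (\<Sum>i<length p. g i) + g (length p)"
      by (metis sum.lessThan_Suc sum.lessThan_Suc_shift add.commute)
    have 2: "g (length p) = g 0"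
      by (simp add: g_def)
    have rot: "rotate i (rotate1 p) = rotate (Suc i) p" for i
      by (simp add: rotate1_rotate_swap)
    have "cyc_deriv_path Q a (rotate1 p) r = (\<Sum>i<length p. g (Suc i))"
      by (simp only: conv length_rotate1 rot g_def)
    moreover have "cyc_deriv_path Q a p r = (\<Sum>i<length p. g i)"
      by (simp only: conv g_def)
    ultimately show ?thesis
      using 1 2 by simp
  qed
  then have 1: "cyc_deriv_path Q a (rotate1 p) = cyc_deriv_path Q a p" for p by auto
  show ?thesis
    by (induction k) (simp_all add: 1)
qed

lemma cyc_deriv_closed:
  assumes "wf_digraph Q" "potential Q W"
  shows "cyc_deriv Q a W \<in> carrier (path_algebra Q)"
proof -
  let ?T = "\<Union>c\<in>{c. W c \<noteq> 0}.
    (\<lambda>i. (head Q a, drop (Suc i) (snd c) @ take i (snd c))) ` {i. i < length (snd c) \<and> snd c ! i = a}"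
  have "r \<in> ?T" if nz: "cyc_deriv Q a W r \<noteq> 0" for r
  proof -
    obtain c where c: "W c \<noteq> 0" "cyc_deriv_path Q a (snd c) r \<noteq> 0"
      using nz unfolding cyc_deriv_def
      by (metis (mono_tags, lifting) mem_Collect_eq mult_eq_0_iff sum.not_neutral_contains_not_neutral)
    obtain i where i: "i \<in> {i. i < length (snd c) \<and> snd c ! i = a}"
      "path_elem (head Q a, drop (Suc i) (snd c) @ take i (snd c)) r \<noteq> 0"
      using c(2) unfolding cyc_deriv_path_def
      by (meson sum.not_neutral_contains_not_neutral)
    then have "r = (head Q a, drop (Suc i) (snd c) @ take i (snd c))"
      by (simp add: path_elem_def split: if_splits)
    then show ?thesis using c(1) i(1) by blast
  qed
  then have "{r. cyc_deriv Q a W r \<noteq> 0} \<subseteq> ?T" by blast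
  moreover have "finite ?T"
    using assms(2) by (auto simp: potential_def)
  moreover have "?T \<subseteq> paths Q"
  proof clarsimp
    fix u p i assume W: "W (u, p) \<noteq> 0" and i: "i < length p" and "a = p ! i"
    have "pre_digraph.awalk Q u p u"
      using W assms(2) by (simp add: potential_def)
    moreover have p: "p = take i p @ p ! i # drop (Suc i) p"
      using i id_take_nth_drop by blast
    ultimately have "set (take i p) \<subseteq> arcs Q" "p ! i \<in> arcs Q" "set (drop (Suc i) p) \<subseteq> arcs Q"
      and cas: "pre_digraph.cas Q u (take i p @ p ! i # drop (Suc i) p) u"
      unfolding pre_digraph.awalk_def
      by (metis set_take_subset order_trans, metis i nth_mem subsetD,
          metis set_drop_subset order_trans, simp)
    moreover obtain v where "pre_digraph.cas Q u (take i p) v"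
        "pre_digraph.cas Q (head Q (p ! i)) (drop (Suc i) p) u"
      using cas unfolding cas_append by (auto simp: pre_digraph.cas.simps)
    then have "pre_digraph.cas Q (head Q (p ! i)) (drop (Suc i) p @ take i p) v"
      unfolding cas_append by blast
    ultimately show "(head Q (p ! i), drop (Suc i) p @ take i p) \<in> paths Q"
      using wf_digraph.head_in_verts[OF assms(1)]
      by (auto simp: paths_def pre_digraph.awalk_def)
  qed
  ultimately show ?thesis
    unfolding path_algebra_simps by (meson finite_subset subset_trans)
qed

lemma jacobian_ideal_ideal:
  assumes "fin_digraph Q" "potential Q W"
  shows "ideal (jacobian_ideal Q W) (path_algebra Q)"
  unfolding jacobian_ideal_def
  using assms by (intro ring.genideal_ideal path_algebra_ring)
    (auto simp: fin_digraph_def intro: cyc_deriv_closed)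

lemma quiverA_fin_digraph: "fin_digraph (quiverA s)"
proof -
  have "vertsA s \<subseteq> {0..int s} \<times> {0..int s} \<times> {0..int s}"
    by (auto simp: vertsA_def)
  then have fin: "finite (vertsA s)"
    by (rule finite_subset) simp
  have "arcs (quiverA s) \<subseteq> vertsA s \<times> {0, 1, 2}"
    by (auto simp: quiverA_def)
  then have "finite (arcs (quiverA s))"
    by (rule finite_subset) (simp add: fin)
  then show ?thesis
    using fin by unfold_locales (auto simp: quiverA_def)
qed

lemma potential_cycle_sum:
  assumes "is \<noteq> []"
  shows "potential (quiverA s) (cycle_sum s is m)"
proof -
  let ?X = "{x. pre_digraph.awalk (quiverA s) x (arrows x is) x}"
  have "?X \<subseteq> verts (quiverA s)"
    by (simp add: subset_iff pre_digraph.awalk_def)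
  then have X: "finite ?X"
    using fin_digraph.finite_verts[OF quiverA_fin_digraph] by (rule finite_subset)
  have mem: "c \<in> (\<lambda>x. (x, arrows x is)) ` ?X" if nz: "cycle_sum s is m c \<noteq> 0" for c
  proof -
    obtain x where x: "x \<in> ?X" "m x * path_elem (x, arrows x is) c \<noteq> 0"
      using nz unfolding cycle_sum_def by (rule sum.not_neutral_contains_not_neutral)
    then have "c = (x, arrows x is)"
      by (simp add: path_elem_def split: if_splits)
    then show ?thesis using x(1) by (rule image_eqI)
  qed
  have ne: "arrows x is \<noteq> []" for x
    using assms by (cases "is") simp_all
  show ?thesis
    unfolding potential_def
  proof (intro conjI allI impI)
    show "finite {c. cycle_sum s is m c \<noteq> 0}"
      by (rule finite_subset[OF _ finite_imageI[OF X]], rule subsetI, rule mem, simp)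
  next
    fix u p assume "cycle_sum s is m (u, p) \<noteq> 0"
    from mem[OF this] show "p \<noteq> []" "pre_digraph.awalk (quiverA s) u p u"
      using ne by (simp_all add: image_iff)
  qed
qed

lemma potential_add:
  assumes "potential Q W" "potential Q W'"
  shows "potential Q (\<lambda>r. W r + z * W' r)"
proof -
  have "{c. W c + z * W' c \<noteq> 0} \<subseteq> {c. W c \<noteq> 0} \<union> {c. W' c \<noteq> 0}" by auto
  moreover have "W (u, p) \<noteq> 0 \<or> W' (u, p) \<noteq> 0" if "W (u, p) + z * W' (u, p) \<noteq> 0" for u p
    using that by auto
  ultimately show ?thesis
    using assms unfolding potential_def
    by (metis (no_types, lifting) finite_UnI finite_subset)
qed

lemma potential_WA: "potential (quiverA s) (WA s)"
  unfolding WA_def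
  using potential_add[OF potential_cycle_sum potential_cycle_sum,
      of "[0, 1, 2]" "[0, 2, 1]" s "\<lambda>_. 1" "- 1" "\<lambda>_. 1"] by simp

lemma potential_VA: "potential (quiverA s) (VA s)"
  unfolding VA_def
  using potential_add[OF potential_cycle_sum potential_cycle_sum,
      of "[0, 1, 2]" "[0, 2, 1]" s "mu012 s" 1 "mu021 s"] by simp

lemma three_cycles_up_to_rotation:
  assumes "pre_digraph.awalk (quiverA s) x p x" "length p = 3"
  shows "\<exists>!(y, is). is \<in> {[0, 1, 2], [0, 2, 1]} \<and>
    pre_digraph.awalk (quiverA s) y (arrows y is) y \<and> (\<exists>k. arrows y is = rotate k p)"
proof -
  have ex_rot: "(\<exists>k. q = rotate k p) \<longleftrightarrow> q \<in> {p, rotate1 p, rotate1 (rotate1 p)}" for q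
  proof
    assume "\<exists>k. q = rotate k p"
    then obtain k where "q = rotate (k mod 3) p"
      using rotate_conv_mod[of _ p] assms(2) by metis
    moreover have "k mod 3 = 0 \<or> k mod 3 = 1 \<or> k mod 3 = 2" by presburger
    ultimately show "q \<in> {p, rotate1 p, rotate1 (rotate1 p)}"
      by (auto simp: numeral_2_eq_2)
  next
    assume "q \<in> {p, rotate1 p, rotate1 (rotate1 p)}"
    then have "q = rotate 0 p \<or> q = rotate 1 p \<or> q = rotate 2 p"
      by (auto simp: numeral_2_eq_2)
    then show "\<exists>k. q = rotate k p" by blast
  qed
  obtain e f g where p: "p = [e, f, g]"
    using assms(2) by (auto simp: length_Suc_conv numeral_3_eq_3)
  have arcs: "e \<in> arcs (quiverA s)" "f \<in> arcs (quiverA s)" "g \<in> arcs (quiverA s)"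
    and cas: "pre_digraph.cas (quiverA s) x [e, f, g] x"
    using assms(1) unfolding p pre_digraph.awalk_def by simp_all
  have sel: "tail (quiverA s) a = fst a" "head (quiverA s) a = fst a + step (snd a)" for a
    by (simp_all add: quiverA_def case_prod_unfold)
  have ends: "fst e = x" "fst f = fst e + step (snd e)" "fst g = fst f + step (snd f)"
      "fst g + step (snd g) = x"
    using cas unfolding pre_digraph.cas.simps sel by blast+
  define i j k where ijk: "i = snd e" "j = snd f" "k = snd g"
  have e: "e = (x, i)" and f: "f = (x + step i, j)" and g: "g = (x + step i + step j, k)"
    and x: "x + step i + step j + step k = x"
  proof -
    have fst: "fst e = x" "fst f = x + step i" "fst g = x + step i + step j"
      using ends(1-3) unfolding ijk by metis+
    then show "e = (x, i)" "f = (x + step i, j)" "g = (x + step i + step j, k)"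
      unfolding ijk by (metis prod.collapse)+
    show "x + step i + step j + step k = x"
      using ends(4) fst(3) unfolding ijk by metis
  qed
  have ijk: "i \<in> {0,1,2}" "j \<in> {0,1,2}" "k \<in> {0,1,2}"
    and V: "x \<in> vertsA s" "x + step i \<in> vertsA s" "x + step i + step j \<in> vertsA s"
    using arcs unfolding e f g quiverA_def by auto
  have 0: "fst (step i) + fst (step j) + fst (step k) = 0"
    "fst (snd (step i)) + fst (snd (step j)) + fst (snd (step k)) = 0"
    using arg_cong[OF x, of fst] arg_cong[OF x, of "fst \<circ> snd"]
    unfolding o_def fst_add snd_add by linarith+
  obtain x0 x1 x2 where xx: "x = (x0, x1, x2)" by (cases x)
  have cases: "(i, j, k) \<in> {(0,1,2), (1,2,0), (2,0,1), (0,2,1), (2,1,0), (1,0,2)}"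
    using ijk 0 unfolding insert_iff empty_iff by (elim disjE) (simp_all add: step_def)
  have unique: ?thesis
    if eq: "\<And>y is. is \<in> {[0, 1, 2], [0, 2, 1]} \<and> arrows y is \<in> {p, rotate1 p, rotate1 (rotate1 p)}
        \<longleftrightarrow> y = Y \<and> is = js"
      and walk: "pre_digraph.awalk (quiverA s) Y (arrows Y js) Y" for Y js
    unfolding ex_rot
  proof (rule ex1I[of _ "(Y, js)"], goal_cases)
    case 1
    then show ?case using eq[of js Y] walk by simp
  next
    case (2 z)
    then show ?case using eq[of "snd z" "fst z"] by (cases z) simp
  qed
  note simps = p e f g xx step_def
  note walk_simps = xx step_def vertsA_def pre_digraph.awalk_def pre_digraph.cas.simps quiverA_def
  from cases consider "i = 0" "j = 1" "k = 2" | "i = 1" "j = 2" "k = 0" | "i = 2" "j = 0" "k = 1"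
    | "i = 0" "j = 2" "k = 1" | "i = 2" "j = 1" "k = 0" | "i = 1" "j = 0" "k = 2" by auto
  then show ?thesis
  proof cases
    case 1
    then show ?thesis
      using V by (intro unique[where js = "[0, 1, 2]" and Y = "x"]) (auto simp: simps, auto simp: walk_simps)
  next
    case 2
    then show ?thesis
      using V by (intro unique[where js = "[0, 1, 2]" and Y = "x + step 1 + step 2"]) (auto simp: simps, auto simp: walk_simps)
  next
    case 3
    then show ?thesis
      using V by (intro unique[where js = "[0, 1, 2]" and Y = "x + step 2"]) (auto simp: simps, auto simp: walk_simps)
  next
    case 4
    then show ?thesis
      using V by (intro unique[where js = "[0, 2, 1]" and Y = "x"]) (auto simp: simps, auto simp: walk_simps)
  next
    case 5
    then show ?thesis
      using V by (intro unique[where js = "[0, 2, 1]" and Y = "x + step 2 + step 1"]) (auto simp: simps, auto simp: walk_simps)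
  next
    case 6
    then show ?thesis
      using V by (intro unique[where js = "[0, 2, 1]" and Y = "x + step 1"]) (auto simp: simps, auto simp: walk_simps)
  qed
qed

end

theory Submission
  imports Defs
begin

text \<open>
  Multiplying every arrow \<open>a\<close> by a nonzero scalar \<open>l a\<close> is an automorphism of the path algebra. It
  multiplies each cycle \<open>c\<close> by the product \<open>l(c)\<close> of the scalars of its arrows, and it maps the
  cyclic derivative of a potential \<open>W\<close> by \<open>a\<close> to a nonzero multiple of the cyclic derivative by \<open>a\<close>
  of the rescaled potential. Two potentials that differ by such a rescaling therefore have
  isomorphic Jacobian algebras (\<open>jacobian_algebra_rescale\<close>).

  It remains to find scalars whose product along every cycle \<open>e\<^sub>x \<alpha>\<^sub>0 \<alpha>\<^sub>1 \<alpha>\<^sub>2\<close> is \<open>\<mu>(e\<^sub>x \<alpha>\<^sub>0 \<alpha>\<^sub>1 \<alpha>\<^sub>2)\<close> and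
  along every cycle \<open>e\<^sub>x \<alpha>\<^sub>0 \<alpha>\<^sub>2 \<alpha>\<^sub>1\<close> is \<open>- \<mu>(e\<^sub>x \<alpha>\<^sub>0 \<alpha>\<^sub>2 \<alpha>\<^sub>1)\<close>. Such scalars exist because the
  triangles tile a contractible region, and they can be written down: put \<open>1\<close> on the arrows
  \<open>\<alpha>\<^sub>1\<close>. If two cycles pass through \<open>e\<^sub>x \<alpha>\<^sub>0\<close>, they use the scalars of \<open>\<alpha>\<^sub>2\<close> at two vertices whose
  coordinates \<open>y\<^sub>2\<close> are \<open>x\<^sub>2 + 1\<close> and \<open>x\<^sub>2\<close>, and the ratio of their weights, the square root of
  \<open>[x\<^sub>2 + 2] / [x\<^sub>2]\<close>, depends on \<open>x\<^sub>2\<close> alone. The scalar \<open>(-1)\<^bsup>y\<^sub>2\<^esup> sqrt([y\<^sub>2] [y\<^sub>2 + 1])\<close> on \<open>\<alpha>\<^sub>2\<close> solves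
  this recursion, and the scalar on \<open>\<alpha>\<^sub>0\<close> is what is left of \<open>\<mu>\<close>. All quantum integers that
  occur are positive, so that the square roots multiply and no scalar vanishes.
\<close>

section \<open>Quotients by corresponding ideals\<close>

lemma image_a_r_coset:
  assumes "h \<in> ring_hom A B" "I \<subseteq> carrier A" "x \<in> carrier A"
  shows "h ` (I +>\<^bsub>A\<^esub> x) = h ` I +>\<^bsub>B\<^esub> h x"
  unfolding a_r_coset_def'
  using assms ring_hom_add[OF assms(1)] by (auto simp: image_iff subset_iff)

text \<open>
  The isomorphism of the quotients sends a coset to its image under \<open>h\<close>. Every operation on cosets
  is an elementwise construction inside the carrier, so it commutes with taking images.
\<close>

lemma algebra_isomorphic_quot_algebra:
  assumes h: "h \<in> ring_iso A B"
    and smult: "\<And>z x. x \<in> carrier A \<Longrightarrow> z \<odot>\<^bsub>A\<^esub> x \<in> carrier A"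
      "\<And>z x. x \<in> carrier A \<Longrightarrow> h (z \<odot>\<^bsub>A\<^esub> x) = z \<odot>\<^bsub>B\<^esub> h x"
    and I: "ideal I A"
  shows "algebra_isomorphic (quot_algebra A I) (quot_algebra B (h ` I))"
proof -
  interpret ideal I A by (rule I)
  have hom: "h \<in> ring_hom A B" and bij: "bij_betw h (carrier A) (carrier B)"
    using h by (auto simp: ring_iso_def)
  have IA: "I \<subseteq> carrier A"
    by (rule a_subset)
  note coset = image_a_r_coset[OF hom IA]
  have carr: "carrier (quot_algebra A I) = (\<lambda>x. I +>\<^bsub>A\<^esub> x) ` carrier A"
    "carrier (quot_algebra B (h ` I)) = (\<lambda>y. h ` I +>\<^bsub>B\<^esub> y) ` carrier B"
    by (auto simp: quot_algebra_def ring.defs module.defs FactRing_def A_RCOSETS_def'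
        a_r_coset_def')
  have sub: "X \<subseteq> carrier A" if "X \<in> carrier (quot_algebra A I)" for X
    using that IA unfolding carr a_r_coset_def' by auto
  have "image h \<in> ring_iso (quot_algebra A I) (quot_algebra B (h ` I))"
  proof (rule ring_iso_memI)
    fix X assume "X \<in> carrier (quot_algebra A I)"
    then show "h ` X \<in> carrier (quot_algebra B (h ` I))"
      using ring_hom_closed[OF hom] unfolding carr by (auto simp: coset)
  next
    fix X Y assume "X \<in> carrier (quot_algebra A I)" "Y \<in> carrier (quot_algebra A I)"
    note XY = this[THEN sub]
    have "h ` (I +>\<^bsub>A\<^esub> (x \<otimes>\<^bsub>A\<^esub> y)) = h ` I +>\<^bsub>B\<^esub> (h x \<otimes>\<^bsub>B\<^esub> h y)" if "x \<in> X" "y \<in> Y" for x y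
    proof -
      have "x \<in> carrier A" "y \<in> carrier A" using XY that by auto
      then show ?thesis by (simp add: coset ring_hom_mult[OF hom])
    qed
    then show "h ` (X \<otimes>\<^bsub>quot_algebra A I\<^esub> Y) = h ` X \<otimes>\<^bsub>quot_algebra B (h ` I)\<^esub> h ` Y"
      by (simp add: quot_algebra_def ring.defs module.defs FactRing_def rcoset_mult_def image_UN)
    have "h (x \<oplus>\<^bsub>A\<^esub> y) = h x \<oplus>\<^bsub>B\<^esub> h y" if "x \<in> X" "y \<in> Y" for x y
      using XY that by (auto intro: ring_hom_add[OF hom])
    then show "h ` (X \<oplus>\<^bsub>quot_algebra A I\<^esub> Y) = h ` X \<oplus>\<^bsub>quot_algebra B (h ` I)\<^esub> h ` Y"
      by (simp add: quot_algebra_def ring.defs module.defs FactRing_def set_add_def' image_UN)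
  next
    show "h ` \<one>\<^bsub>quot_algebra A I\<^esub> = \<one>\<^bsub>quot_algebra B (h ` I)\<^esub>"
      by (simp add: quot_algebra_def ring.defs module.defs FactRing_def coset ring_hom_one[OF hom])
  next
    have "inj_on (image h) (carrier (quot_algebra A I))"
      by (rule inj_onI) (simp only: inj_on_image_eq_iff[OF bij_betw_imp_inj_on[OF bij] sub sub])
    moreover have "image h ` carrier (quot_algebra A I) = carrier (quot_algebra B (h ` I))"
      unfolding carr bij_betw_imp_surj_on[OF bij, symmetric] image_image
      by (rule image_cong) (simp_all only: coset)
    ultimately show "bij_betw (image h) (carrier (quot_algebra A I)) (carrier (quot_algebra B (h ` I)))"
      by (simp add: bij_betw_def)
  qed
  moreover have "h ` (z \<odot>\<^bsub>quot_algebra A I\<^esub> X) = z \<odot>\<^bsub>quot_algebra B (h ` I)\<^esub> h ` X"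
    if "X \<in> carrier (quot_algebra A I)" for z X
  proof -
    have "h ` (I +>\<^bsub>A\<^esub> (z \<odot>\<^bsub>A\<^esub> x)) = h ` I +>\<^bsub>B\<^esub> (z \<odot>\<^bsub>B\<^esub> h x)" if "x \<in> X" for x
    proof -
      have "x \<in> carrier A" using sub[OF \<open>X \<in> _\<close>] that by blast
      then show ?thesis by (simp only: coset smult)
    qed
    then show ?thesis
      by (simp add: quot_algebra_def ring.defs module.defs image_UN)
  qed
  ultimately show ?thesis
    unfolding algebra_isomorphic_def by blast
qed

text \<open>The preimage of the ideal on the right is an ideal that contains the generators \<open>X\<close>.\<close>

lemma image_genideal_subset:
  assumes A: "ring A" and B: "ring B" and h: "h \<in> ring_hom A B"
    and X: "X \<subseteq> carrier A" and Y: "Y \<subseteq> carrier B" and gen: "h ` X \<subseteq> genideal B Y"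
  shows "h ` genideal A X \<subseteq> genideal B Y"
proof -
  interpret ring_hom_ring A B h
    using A B h by (rule ring_hom_ringI2)
  have "ideal {r \<in> carrier A. h r \<in> genideal B Y} A"
    by (intro ideal_vimage S.genideal_ideal Y)
  then have "genideal A X \<subseteq> {r \<in> carrier A. h r \<in> genideal B Y}"
    by (rule R.genideal_minimal) (use X gen in auto)
  then show ?thesis by blast
qed

section \<open>Rescaling the arrows of a quiver\<close>

definition path_scale :: "('a \<Rightarrow> complex) \<Rightarrow> 'a list \<Rightarrow> complex" where
  "path_scale l p = prod_list (map l p)"

definition rescale :: "('a \<Rightarrow> complex) \<Rightarrow> (('v, 'a) path \<Rightarrow> complex) \<Rightarrow> ('v, 'a) path \<Rightarrow> complex" where
  "rescale l f = (\<lambda>c. path_scale l (snd c) * f c)"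

lemma path_scale_append: "path_scale l (p @ p') = path_scale l p * path_scale l p'"
  by (simp add: path_scale_def)

lemma path_scale_nonzero: "(\<And>a. a \<in> set p \<Longrightarrow> l a \<noteq> 0) \<Longrightarrow> path_scale l p \<noteq> 0"
  by (auto simp: path_scale_def prod_list_zero_iff)

lemma path_scale_inverse: "path_scale (\<lambda>a. inverse (l a)) p = inverse (path_scale l p)"
  by (induction p) (simp_all add: path_scale_def)

lemma rescale_inverse:
  assumes "\<And>u p. f (u, p) \<noteq> 0 \<Longrightarrow> set p \<subseteq> arcs Q" "\<forall>a\<in>arcs Q. l a \<noteq> 0"
  shows "rescale (\<lambda>a. inverse (l a)) (rescale l f) = f"
proof (rule ext, clarify)
  fix u p
  have "path_scale l p \<noteq> 0" if "f (u, p) \<noteq> 0"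
    using assms(1)[OF that] assms(2) by (intro path_scale_nonzero) auto
  then show "rescale (\<lambda>a. inverse (l a)) (rescale l f) (u, p) = f (u, p)"
    by (cases "f (u, p) = 0") (simp_all add: rescale_def path_scale_inverse)
qed

lemma path_algebra_support_arcs:
  assumes "f \<in> carrier (path_algebra Q)" "f (u, p) \<noteq> 0"
  shows "set p \<subseteq> arcs Q"
  using assms by (auto simp: path_algebra_simps(1) mem_paths_iff subset_iff)

lemma potential_support_arcs:
  assumes "potential Q W" "W (u, p) \<noteq> 0"
  shows "set p \<subseteq> arcs Q"
  using assms by (auto simp: potential_def pre_digraph.awalk_def)

lemma rescale_closed:
  assumes "f \<in> carrier (path_algebra Q)"
  shows "rescale l f \<in> carrier (path_algebra Q)"
proof -
  have "{c. rescale l f c \<noteq> 0} \<subseteq> {c. f c \<noteq> 0}" by (auto simp: rescale_def)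
  then show ?thesis
    using assms unfolding path_algebra_simps(1) by (meson finite_subset order_trans)
qed

lemma rescale_smult: "rescale l (z \<odot>\<^bsub>path_algebra Q\<^esub> f) = z \<odot>\<^bsub>path_algebra Q\<^esub> rescale l f"
  by (auto simp: rescale_def path_algebra_simps)

lemma rescale_ring_hom:
  fixes Q :: "('v, 'a) pre_digraph"
  shows "rescale l \<in> ring_hom (path_algebra Q) (path_algebra Q)"
proof (rule ring_hom_memI)
  fix f g :: "('v, 'a) path \<Rightarrow> complex"
  have "path_scale l p * (f (u, take k p) * g (v, drop k p)) =
      path_scale l (take k p) * f (u, take k p) * (path_scale l (drop k p) * g (v, drop k p))"
    for u v k p
    using path_scale_append[of l "take k p" "drop k p"] by (simp add: mult_ac)
  note cut = this
  show "rescale l (f \<otimes>\<^bsub>path_algebra Q\<^esub> g) = rescale l f \<otimes>\<^bsub>path_algebra Q\<^esub> rescale l g"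
    by (intro ext) (auto simp: rescale_def path_algebra_simps sum_distrib_left cut intro!: sum.cong)
  show "rescale l (f \<oplus>\<^bsub>path_algebra Q\<^esub> g) = rescale l f \<oplus>\<^bsub>path_algebra Q\<^esub> rescale l g"
    by (auto simp: rescale_def path_algebra_simps algebra_simps)
next
  show "rescale l \<one>\<^bsub>path_algebra Q\<^esub> = \<one>\<^bsub>path_algebra Q\<^esub>"
    by (intro ext) (auto simp: rescale_def path_algebra_simps path_scale_def)
qed (rule rescale_closed)

lemma rescale_ring_iso:
  fixes Q :: "('v, 'a) pre_digraph"
  assumes "\<forall>a\<in>arcs Q. l a \<noteq> 0"
  shows "rescale l \<in> ring_iso (path_algebra Q) (path_algebra Q)"
proof -
  have inv: "rescale (\<lambda>a. inverse (l a)) (rescale l f) = f"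
    if "f \<in> carrier (path_algebra Q)" "\<forall>a\<in>arcs Q. l a \<noteq> 0" for l and f :: "('v, 'a) path \<Rightarrow> complex"
    using path_algebra_support_arcs[OF that(1)] that(2) by (rule rescale_inverse)
  have "bij_betw (rescale l) (carrier (path_algebra Q)) (carrier (path_algebra Q))"
    by (rule bij_betw_byWitness[where f' = "rescale (\<lambda>a. inverse (l a))"])
      (use inv[of _ l] inv[of _ "\<lambda>a. inverse (l a)"] assms in \<open>auto intro: rescale_closed\<close>)
  then show ?thesis
    using rescale_ring_hom by (simp add: ring_iso_def)
qed

text \<open>
  Cutting the arrow \<open>a\<close> out of a cycle leaves a path whose scalar is that of the cycle divided by
  \<open>l a\<close>.
\<close>

lemma cyc_deriv_path_rescale:
  "path_scale l p * cyc_deriv_path Q a p r = l a * path_scale l (snd r) * cyc_deriv_path Q a p r"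
proof -
  have "path_scale l p * path_elem (head Q a, drop (Suc i) p @ take i p) r =
      l a * path_scale l (snd r) * path_elem (head Q a, drop (Suc i) p @ take i p) r"
    if "i < length p" "p ! i = a" for i
  proof -
    have "path_scale l p = path_scale l (take i p @ a # drop (Suc i) p)"
      using that id_take_nth_drop by metis
    also have "\<dots> = l a * path_scale l (drop (Suc i) p @ take i p)"
      by (simp add: path_scale_def)
    finally show ?thesis
      by (simp add: path_elem_def)
  qed
  then show ?thesis
    unfolding cyc_deriv_path_def sum_distrib_left by (intro sum.cong) auto
qed

lemma cyc_deriv_rescale:
  assumes W: "potential Q W" and l: "\<forall>a\<in>arcs Q. l a \<noteq> 0"
  shows "cyc_deriv Q a (rescale l W) = l a \<odot>\<^bsub>path_algebra Q\<^esub> rescale l (cyc_deriv Q a W)"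
proof
  fix r
  have "path_scale l p \<noteq> 0" if "W (u, p) \<noteq> 0" for u p
    using potential_support_arcs[OF W that] l by (intro path_scale_nonzero) auto
  then have supp: "rescale l W c \<noteq> 0 \<longleftrightarrow> W c \<noteq> 0" for c
    by (cases c) (auto simp: rescale_def)
  have summand: "rescale l W c * cyc_deriv_path Q a (snd c) r =
      l a * (path_scale l (snd r) * (W c * cyc_deriv_path Q a (snd c) r))" for c
    using cyc_deriv_path_rescale[of l "snd c" Q a r] by (simp add: rescale_def mult_ac)
  show "cyc_deriv Q a (rescale l W) r =
      (l a \<odot>\<^bsub>path_algebra Q\<^esub> rescale l (cyc_deriv Q a W)) r"
    unfolding cyc_deriv_def supp summand path_algebra_simps
    unfolding rescale_def by (simp only: sum_distrib_left)
qed

lemma potential_rescale: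
  assumes "potential Q W"
  shows "potential Q (rescale l W)"
proof -
  have "{c. rescale l W c \<noteq> 0} \<subseteq> {c. W c \<noteq> 0}" by (auto simp: rescale_def)
  then show ?thesis
    using assms unfolding potential_def by (auto simp: rescale_def intro: finite_subset)
qed

text \<open>The scalar \<open>z\<close> acts as multiplication by the element \<open>z \<cdot> 1\<close>.\<close>

lemma ideal_smult_closed:
  assumes "fin_digraph Q" "ideal I (path_algebra Q)" "f \<in> I"
  shows "z \<odot>\<^bsub>path_algebra Q\<^esub> f \<in> I"
proof -
  have wf: "wf_digraph Q" using assms(1) by (simp add: fin_digraph_def)
  have f: "f \<in> carrier (path_algebra Q)"
    using assms(2,3) additive_subgroup.a_subset ideal.axioms(1) by blast
  have "(z \<odot>\<^bsub>path_algebra Q\<^esub> \<one>\<^bsub>path_algebra Q\<^esub>) \<otimes>\<^bsub>path_algebra Q\<^esub> f \<in> I"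
    using assms path_algebra_smult_closed[OF path_algebra_one_closed[OF assms(1)]]
    by (intro ideal.I_l_closed)
  then show ?thesis
    by (simp add: path_algebra_smult_mult path_algebra_one_mult[OF wf f])
qed

text \<open>
  Since \<open>l a\<close> is invertible, the image of the generator for \<open>a\<close> is a scalar multiple of the
  corresponding generator of the ideal on the right.
\<close>

lemma rescale_jacobian_ideal_subset:
  assumes Q: "fin_digraph Q" and W: "potential Q W" and l: "\<forall>a\<in>arcs Q. l a \<noteq> 0"
  shows "rescale l ` jacobian_ideal Q W \<subseteq> jacobian_ideal Q (rescale l W)"
  unfolding jacobian_ideal_def
proof (rule image_genideal_subset[OF path_algebra_ring[OF Q] path_algebra_ring[OF Q] rescale_ring_hom])
  have wf: "wf_digraph Q" using Q by (simp add: fin_digraph_def)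
  show "{cyc_deriv Q a W |a. a \<in> arcs Q} \<subseteq> carrier (path_algebra Q)"
    using cyc_deriv_closed[OF wf W] by blast
  show sub: "{cyc_deriv Q a (rescale l W) |a. a \<in> arcs Q} \<subseteq> carrier (path_algebra Q)"
    using cyc_deriv_closed[OF wf potential_rescale[OF W]] by blast
  let ?J = "genideal (path_algebra Q) {cyc_deriv Q a (rescale l W) |a. a \<in> arcs Q}"
  have "rescale l (cyc_deriv Q a W) \<in> ?J" if a: "a \<in> arcs Q" for a
  proof -
    have "cyc_deriv Q a (rescale l W) \<in> ?J"
      using ring.genideal_self[OF path_algebra_ring[OF Q] sub] a by blast
    then have "inverse (l a) \<odot>\<^bsub>path_algebra Q\<^esub> cyc_deriv Q a (rescale l W) \<in> ?J"
      by (intro ideal_smult_closed[OF Q] ring.genideal_ideal path_algebra_ring Q sub)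
    then show ?thesis
      using l a by (simp add: cyc_deriv_rescale[OF W l] path_algebra_simps mult.assoc[symmetric])
  qed
  then show "rescale l ` {cyc_deriv Q a W |a. a \<in> arcs Q} \<subseteq> ?J"
    by blast
qed

text \<open>The reverse inclusion is the same statement for the inverse scalars.\<close>

lemma rescale_jacobian_ideal:
  assumes Q: "fin_digraph Q" and W: "potential Q W" and l: "\<forall>a\<in>arcs Q. l a \<noteq> 0"
  shows "rescale l ` jacobian_ideal Q W = jacobian_ideal Q (rescale l W)"
proof (rule antisym[OF rescale_jacobian_ideal_subset[OF assms] subsetI])
  fix f assume f: "f \<in> jacobian_ideal Q (rescale l W)"
  let ?k = "\<lambda>a. inverse (l a)"
  have k: "\<forall>a\<in>arcs Q. ?k a \<noteq> 0" using l by simp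
  have fc: "f \<in> carrier (path_algebra Q)"
    using f jacobian_ideal_ideal[OF Q potential_rescale[OF W]]
      additive_subgroup.a_subset ideal.axioms(1) by blast
  have "rescale ?k f \<in> jacobian_ideal Q (rescale ?k (rescale l W))"
    using rescale_jacobian_ideal_subset[OF Q potential_rescale[OF W] k] f by blast
  moreover have "rescale ?k (rescale l W) = W"
    using potential_support_arcs[OF W] l by (rule rescale_inverse)
  moreover have "rescale l (rescale ?k f) = f"
    using rescale_inverse[of f Q ?k] path_algebra_support_arcs[OF fc] k by simp
  ultimately show "f \<in> rescale l ` jacobian_ideal Q W"
    by (metis imageI)
qed

lemma jacobian_algebra_rescale:
  assumes Q: "fin_digraph Q" and W: "potential Q W" and l: "\<forall>a\<in>arcs Q. l a \<noteq> 0"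
  shows "algebra_isomorphic (jacobian_algebra Q W) (jacobian_algebra Q (rescale l W))"
  unfolding jacobian_algebra_def rescale_jacobian_ideal[OF assms, symmetric]
  by (rule algebra_isomorphic_quot_algebra[OF rescale_ring_iso[OF l] _ _ jacobian_ideal_ideal[OF Q W]])
    (erule path_algebra_smult_closed, rule rescale_smult)

section \<open>Quantum integers at a root of unity\<close>

definition qreal :: "nat \<Rightarrow> int \<Rightarrow> real" where
  "qreal s n = sin (of_int n * pi / (real s + 2)) / sin (pi / (real s + 2))"

lemma qnum_eq_qreal: "qnum s n = complex_of_real (qreal s n)"
proof -
  have pw: "qpar s powi k = cis (of_int k * pi / (real s + 2))" for k
  proof -
    have "qpar s = cis (pi / (real s + 2))"
      by (simp add: qpar_def cis_conv_exp mult.commute add.commute)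
    then show ?thesis by (simp add: cis_power_int)
  qed
  have dif: "qpar s powi k - qpar s powi (- k) =
      2 * \<i> * complex_of_real (sin (of_int k * pi / (real s + 2)))" for k
    unfolding pw by (simp add: complex_eq_iff)
  have "qnum s n = (qpar s powi n - qpar s powi (- n)) / (qpar s powi 1 - qpar s powi (- 1))"
    by (simp add: qnum_def power_int_minus)
  then show ?thesis
    unfolding dif by (simp add: qreal_def)
qed

lemma qreal_pos:
  assumes "0 < n" "n < int s + 2"
  shows "0 < qreal s n"
proof -
  have "real_of_int n < real s + 2" using assms(2) by linarith
  then have "of_int n * pi < (real s + 2) * pi"
    using pi_gt_zero by (rule mult_strict_right_mono)
  then have "of_int n * pi / (real s + 2) < pi"
    by (simp add: divide_less_eq mult.commute)
  then show ?thesis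
    unfolding qreal_def using assms(1)
    by (intro divide_pos_pos sin_gt_zero) (simp_all add: divide_less_eq add_pos_nonneg)
qed

lemma qreal_nonneg: "0 \<le> n \<Longrightarrow> n < int s + 2 \<Longrightarrow> 0 \<le> qreal s n"
  using qreal_pos[of n s] by (cases "n = 0") (auto simp: qreal_def)

section \<open>Scalars on the arrows of the triangular quiver\<close>

fun arrow_scale :: "nat \<Rightarrow> arrow \<Rightarrow> complex" where
  "arrow_scale s ((x0, x1, x2), i) =
    (if i = 0 then (-1) powi (x2 + 1) * complex_of_real
        (sqrt (qreal s (x1 + 1) * qreal s (x1 + 2) * qreal s (x1 + x2 + 2) * qreal s (x1 + x2 + 3))
          / qreal s 2)
     else if i = 1 then 1
     else (-1) powi x2 * complex_of_real (sqrt (qreal s x2 * qreal s (x2 + 1))))"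

text \<open>
  On an arrow \<open>\<alpha>\<^sub>0\<close> the coordinate \<open>x\<^sub>0\<close> is positive, so that \<open>x\<^sub>1 + x\<^sub>2 + 3\<close> is at most \<open>s + 1\<close>, and on
  an arrow \<open>\<alpha>\<^sub>2\<close> the coordinate \<open>x\<^sub>2\<close> is positive: all quantum integers are in the positive range.
\<close>

lemma arrow_scale_nonzero:
  assumes "s \<ge> 2"
  shows "\<forall>a\<in>arcs (quiverA s). arrow_scale s a \<noteq> 0"
proof
  fix a assume arc: "a \<in> arcs (quiverA s)"
  obtain x0 x1 x2 i where a: "a = ((x0, x1, x2), i)" by (metis prod.collapse)
  have nz: "qreal s n \<noteq> 0" if "0 < n" "n < int s + 2" for n
    using qreal_pos[OF that] by simp
  show "arrow_scale s a \<noteq> 0"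
    using assms arc unfolding a
    by (auto simp: quiverA_def vertsA_def step_def nz)
qed

text \<open>
  The arrows \<open>\<alpha>\<^sub>0\<close> and \<open>\<alpha>\<^sub>2\<close> of \<open>e\<^sub>x \<alpha>\<^sub>0 \<alpha>\<^sub>1 \<alpha>\<^sub>2\<close> both carry the sign \<open>(-1)\<^bsup>x\<^sub>2 + 1\<^esup>\<close>; in
  \<open>e\<^sub>x \<alpha>\<^sub>0 \<alpha>\<^sub>2 \<alpha>\<^sub>1\<close> the arrow \<open>\<alpha>\<^sub>2\<close> starts one level lower, which gives the minus sign below.
\<close>

lemma path_scale_012:
  assumes "pre_digraph.awalk (quiverA s) x (arrows x [0, 1, 2]) x"
  shows "path_scale (arrow_scale s) (arrows x [0, 1, 2]) = mu012 s x"
proof -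
  obtain x0 x1 x2 where x: "x = (x0, x1, x2)" by (metis prod.collapse)
  have bounds: "0 < x0" "0 \<le> x1" "0 \<le> x2" "x0 + x1 + x2 = int s - 1"
    using assms unfolding x
    by (auto simp: pre_digraph.awalk_def quiverA_def vertsA_def step_def)
  have nn: "0 \<le> qreal s n" if "n \<in> {x1 + 1, x1 + 2, x2 + 1, x2 + 2, x1 + x2 + 2, x1 + x2 + 3}" for n
    using that bounds by (intro qreal_nonneg) auto
  have sign: "(-1) powi (x2 + 1) * (-1) powi (x2 + 1) = (1 :: complex)"
    by (simp add: power_int_mult_distrib[symmetric])
  have "mu012 s x = complex_of_real (sqrt (qreal s (x1 + 1) * qreal s (x1 + 2) * qreal s (x2 + 1)
      * qreal s (x2 + 2) * qreal s (x1 + x2 + 2) * qreal s (x1 + x2 + 3)) / qreal s 2)"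
    unfolding x using nn by (simp add: qnum_eq_qreal of_real_mult[symmetric] del: of_real_mult)
  moreover have "path_scale (arrow_scale s) (arrows x [0, 1, 2]) =
      ((-1) powi (x2 + 1) * (-1) powi (x2 + 1)) * complex_of_real
      (sqrt (qreal s (x1 + 1) * qreal s (x1 + 2) * qreal s (x1 + x2 + 2) * qreal s (x1 + x2 + 3))
        / qreal s 2 * sqrt (qreal s (x2 + 1) * qreal s (x2 + 2)))"
    unfolding x by (simp add: path_scale_def step_def add.commute)
  ultimately show ?thesis
    unfolding sign by (simp add: real_sqrt_mult mult_ac)
qed

lemma path_scale_021:
  assumes "pre_digraph.awalk (quiverA s) x (arrows x [0, 2, 1]) x"
  shows "path_scale (arrow_scale s) (arrows x [0, 2, 1]) = - mu021 s x"
proof -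
  obtain x0 x1 x2 where x: "x = (x0, x1, x2)" by (metis prod.collapse)
  have bounds: "0 < x0" "0 \<le> x1" "0 < x2" "x0 + x1 + x2 = int s - 1"
    using assms unfolding x
    by (auto simp: pre_digraph.awalk_def quiverA_def vertsA_def step_def)
  have nn: "0 \<le> qreal s n" if "n \<in> {x1 + 1, x1 + 2, x2, x2 + 1, x1 + x2 + 2, x1 + x2 + 3}" for n
    using that bounds by (intro qreal_nonneg) auto
  have sign: "(-1) powi (x2 + 1) * (-1) powi x2 = (- 1 :: complex)"
    by (simp add: power_int_add power_int_mult_distrib[symmetric])
  have "mu021 s x = complex_of_real (sqrt (qreal s (x1 + 1) * qreal s (x1 + 2) * qreal s x2
      * qreal s (x2 + 1) * qreal s (x1 + x2 + 2) * qreal s (x1 + x2 + 3)) / qreal s 2)"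
    unfolding x using nn by (simp add: qnum_eq_qreal of_real_mult[symmetric] del: of_real_mult)
  moreover have "path_scale (arrow_scale s) (arrows x [0, 2, 1]) =
      ((-1) powi (x2 + 1) * (-1) powi x2) * complex_of_real
      (sqrt (qreal s (x1 + 1) * qreal s (x1 + 2) * qreal s (x1 + x2 + 2) * qreal s (x1 + x2 + 3))
        / qreal s 2 * sqrt (qreal s x2 * qreal s (x2 + 1)))"
    unfolding x by (simp add: path_scale_def step_def add.commute)
  ultimately show ?thesis
    unfolding sign by (simp add: real_sqrt_mult mult_ac)
qed

lemma cycle_sum_apply:
  "cycle_sum s is m (u, p) =
    (if pre_digraph.awalk (quiverA s) u (arrows u is) u \<and> p = arrows u is then m u else 0)"
proof -
  let ?X = "{x. pre_digraph.awalk (quiverA s) x (arrows x is) x}"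
  have "?X \<subseteq> verts (quiverA s)"
    by (auto simp: pre_digraph.awalk_def)
  then have X: "finite ?X"
    using fin_digraph.finite_verts[OF quiverA_fin_digraph] by (rule finite_subset)
  have "cycle_sum s is m (u, p) = (\<Sum>x\<in>?X. if u = x then (if p = arrows u is then m u else 0) else 0)"
    unfolding cycle_sum_def path_elem_def by (intro sum.cong) auto
  then show ?thesis
    using X by simp
qed

lemma rescale_WA: "rescale (arrow_scale s) (WA s) = VA s"
proof (rule ext, clarify)
  fix u p
  have "rescale (arrow_scale s) (cycle_sum s [0, 1, 2] (\<lambda>_. 1)) (u, p) =
      cycle_sum s [0, 1, 2] (mu012 s) (u, p)"
    using path_scale_012[of s u] by (simp add: rescale_def cycle_sum_apply del: arrows.simps)
  moreover have "rescale (arrow_scale s) (cycle_sum s [0, 2, 1] (\<lambda>_. 1)) (u, p) =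
      - cycle_sum s [0, 2, 1] (mu021 s) (u, p)"
    using path_scale_021[of s u] by (simp add: rescale_def cycle_sum_apply del: arrows.simps)
  ultimately show "rescale (arrow_scale s) (WA s) (u, p) = VA s (u, p)"
    unfolding WA_def VA_def rescale_def by (simp add: right_diff_distrib)
qed

theorem proposition4p5:
  fixes s :: nat
  assumes "s \<ge> 2"
  shows "algebra_isomorphic (PiA s) (jacobian_algebra (quiverA s) (VA s))"
  using jacobian_algebra_rescale[OF quiverA_fin_digraph potential_WA arrow_scale_nonzero[OF assms]]
  unfolding PiA_def rescale_WA .

end
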